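(* Let the Fibonacci triangle $\mathcal{F}$ be defined as follows. Each row $n\ge1$ is a finite sequence of positive integers together with a partition of it into groups of consecutive entries, each group having two or three entries. Row $1$ is $1,1$, forming a single group. Row $n+1$ is obtained from row $n$ as follows: imagine a $0$ placed before the first entry of row $n$, regarded as the last element of a group, and a $0$ placed after the last entry, regarded as the first element of a group. Reading left to right, for each pair of consecutive entries $a_j,a_{j+1}$ (possibly involving these imagined $0$'s) such that $a_j$ ends a group and $a_{j+1}$ begins a group, write the $3$-element group $a_j,\,a_j+a_{j+1},\,a_{j+1}$; for each entry $a_j$ which is the middle element of a $3$-element group, write the $2$-element group $a_j,a_j$; finally delete the two $0$'s arising from the imagined $0$'s (so the first and last groups of row $n+1$ become $2$-element groups). (Thus rows $2,3,4$ are $1,1\,|\,1,1$; $1,1\,|\,1,2,1\,|\,1,1$; $1,1\,|\,1,2,1\,|\,2,2\,|\,1,2,1\,|\,1,1$.) Let $\langle n,k\rangle$ denote the $k$th entry ($k\ge0$) of row $n$, and $H_n(x)=\sum_{k\ge0}\langle n,k\rangle x^k$. Then for all $n\ge1$, $$H_n(x)=\prod_{i=1}^n\left(1+x^{F_{i+1}}\right),$$ where $F_j$ are the Fibonacci numbers with $F_1=F_2=1$. *)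

theory Defs
  imports "HOL-Number_Theory.Fib" "HOL-Computational_Algebra.Polynomial"
begin

text \<open>
  A row of the Fibonacci triangle, with its partition into groups, is the list of its groups;
  the underlying sequence of entries is the concatenation.
\<close>

type_synonym row = "nat list list"

fun middle_groups :: "nat list \<Rightarrow> row" where
  "middle_groups [a, b, c] = [[b, b]]"
| "middle_groups _ = []"

text \<open>
  The left-to-right pass over the groups: the middle entry of each 3-element group gives a
  2-element group, each boundary between two adjacent groups gives a 3-element group.
\<close>

fun expand :: "row \<Rightarrow> row" where
  "expand [] = []"
| "expand [g] = middle_groups g"
| "expand (g # h # gs) =
     middle_groups g @ [last g, last g + hd h, hd h] # expand (h # gs)"

definition delete_ends :: "row \<Rightarrow> row" where
  "delete_ends gs = tl (hd gs) # butlast (tl gs) @ [butlast (last gs)]"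

text \<open>
  The imagined zeros are the one-element groups \<open>[0]\<close> at either end; only the last entry of the
  left one and the first entry of the right one are ever used.
\<close>

definition next_row :: "row \<Rightarrow> row" where
  "next_row r = delete_ends (expand ([0] # r @ [[0]]))"

text \<open>Rows are numbered from 1; the value at 0 is a dummy.\<close>

fun fib_row :: "nat \<Rightarrow> row" where
  "fib_row 0 = []"
| "fib_row (Suc 0) = [[1, 1]]"
| "fib_row (Suc (Suc n)) = next_row (fib_row (Suc n))"

definition row_length :: "nat \<Rightarrow> nat" where
  "row_length n = length (concat (fib_row n))"

text \<open>Entries are indexed from 0, and are 0 beyond the end of the row.\<close>

definition entry :: "nat \<Rightarrow> nat \<Rightarrow> nat" where
  "entry n k = nth_default 0 (concat (fib_row n)) k"

definition H :: "nat \<Rightarrow> int poly" where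
  "H n = (\<Sum>k<row_length n. monom (int (entry n k)) k)"

lemma coeff_H: "coeff (H n) k = int (entry n k)"
  by (auto simp: H_def coeff_sum entry_def row_length_def nth_default_def)

lemma fib_row_2_3_4:
  "fib_row 2 = [[1,1],[1,1]]"
  "fib_row 3 = [[1,1],[1,2,1],[1,1]]"
  "fib_row 4 = [[1,1],[1,2,1],[2,2],[1,2,1],[1,1]]"
  by (simp_all add: eval_nat_numeral next_row_def delete_ends_def)

end

theory Submission
  imports Defs
begin

text \<open>
  Write \<open>w k = \<lfloor>k \<phi>\<rfloor>\<close> with \<open>\<phi>\<close> the golden ratio. For every finite set \<open>S\<close> of indices \<open>\<ge> 2\<close>,
  \<open>w (1 + \<Sum>i\<in>S. F\<^sub>i) = 1 + (\<Sum>i\<in>S. F\<^sub>i\<^sub>+\<^sub>1)\<close>, because \<open>F\<^sub>i\<^sub>+\<^sub>1 - \<phi> F\<^sub>i = (1 - \<phi>)\<^sup>i\<close> and the sums of these powers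
  stay in an interval of length 1. Hence the linear map \<open>x\<^sup>k \<mapsto> x\<^bsup>w (k + 1) - 1\<^esup> (1 + x)\<close> turns
  \<open>\<Prod>i = 1..n. 1 + x\<^bsup>F (i + 1)\<^esup>\<close> into the same product up to \<open>n + 1\<close>.

  The passage from one row to the next is this same map. By induction, two consecutive entries
  \<open>k\<close> and \<open>k + 1\<close> of a row belong to different groups iff \<open>w (k + 2) - w (k + 1) = 1\<close>, and to the
  same group iff this difference is 2. So a boundary makes the contributions of its two neighbours
  overlap in one position, giving \<open>a, a + b, b\<close>, and a middle entry \<open>b\<close> contributes \<open>b, b\<close>
  without overlap. That the new row again has this property is the fact that \<open>w (m + 1) - w m = 2\<close>
  iff \<open>m\<close> is a value of \<open>w\<close> (for \<open>m \<ge> 1\<close>).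
\<close>

section \<open>The golden ratio and its irrationality\<close>

definition phi :: real where
  "phi = (1 + sqrt 5) / 2"

lemma phi_square: "phi * phi = phi + 1"
  by (simp add: phi_def field_simps)

lemma phi_bounds: "8 / 5 < phi" "phi < 13 / 8"
proof -
  have "11 / 5 < sqrt 5"
    by (rule real_less_rsqrt) (simp add: power2_eq_square)
  moreover have "sqrt 5 < 9 / 4"
    by (rule real_less_lsqrt) (simp_all add: power2_eq_square)
  ultimately show "8 / 5 < phi" "phi < 13 / 8"
    by (auto simp: phi_def)
qed

lemma of_nat_mult_phi_neq_of_nat:
  assumes "k > 0"
  shows "real k * phi \<noteq> real m"
  using assms
proof (induction k arbitrary: m rule: less_induct)
  case (less k)
  show ?case
  proof
    assume eq: "real k * phi = real m"
    have "real k * 1 < real k * phi" "real k * phi < real k * 2"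
      using less.prems phi_bounds by simp_all
    then have m: "k < m" "m < 2 * k"
      using eq by simp_all
    \<comment> \<open>descent from \<open>(k, m)\<close> to \<open>(m - k, k)\<close>\<close>
    have "real (m - k) * phi = real k * (phi * phi) - real k * phi"
      using m eq by (simp add: of_nat_diff algebra_simps)
    also have "\<dots> = real k"
      unfolding phi_square by (simp add: algebra_simps)
    finally show False
      using less.IH[of "m - k" k] m by linarith
  qed
qed

section \<open>Gaps of the lower Wythoff sequence\<close>

definition wythoff :: "nat \<Rightarrow> nat" where
  "wythoff k = nat \<lfloor>real k * phi\<rfloor>"

lemma wythoff_bounds:
  "real (wythoff k) \<le> real k * phi" "real k * phi < real (wythoff k) + 1"
proof -
  have "0 \<le> real k * phi"
    using phi_bounds by simp
  then show "real (wythoff k) \<le> real k * phi" "real k * phi < real (wythoff k) + 1"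
    unfolding wythoff_def by linarith+
qed

lemma wythoff_eqI:
  assumes "real m \<le> real k * phi" "real k * phi < real m + 1"
  shows "wythoff k = m"
  using wythoff_bounds[of k] assms by linarith

lemma wythoff_0 [simp]: "wythoff 0 = 0"
  by (simp add: wythoff_def)

lemma wythoff_1 [simp]: "wythoff (Suc 0) = 1"
  using phi_bounds by (intro wythoff_eqI) auto

lemma wythoff_2 [simp]: "wythoff 2 = 3" "wythoff (Suc (Suc 0)) = 3"
  using phi_bounds by (auto intro!: wythoff_eqI)

lemma wythoff_mult_phi:
  fixes i :: nat
  defines "f \<equiv> real i * phi - real (wythoff i)"
  shows "real (wythoff i) * phi = real (wythoff i) + real i - f * (phi - 1)"
proof -
  have "real (wythoff i) * phi = real i * (phi * phi) - f * phi"
    by (simp add: f_def algebra_simps)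
  also have "\<dots> = real (wythoff i) + real i - f * (phi - 1)"
    unfolding phi_square by (simp add: f_def algebra_simps)
  finally show ?thesis .
qed

text \<open>The fractional part of \<open>wythoff i * phi\<close> is \<open>1 - c\<close> with
  \<open>0 < c < phi - 1\<close>, so adding \<open>phi\<close> passes two integers.\<close>

lemma wythoff_Suc_wythoff:
  assumes "i > 0"
  shows "wythoff (Suc (wythoff i)) = wythoff (wythoff i) + 2"
proof -
  define f where "f = real i * phi - real (wythoff i)"
  have f: "0 < f" "f < 1"
    using wythoff_bounds[of i] of_nat_mult_phi_neq_of_nat[OF assms, of "wythoff i"]
    unfolding f_def by linarith+
  define c where "c = f * (phi - 1)"
  have g: "0 < c" "c < phi - 1"
    using f phi_bounds by (simp_all add: c_def)
  have eq: "real (wythoff i) * phi = real (wythoff i) + real i - c"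
    unfolding c_def f_def by (rule wythoff_mult_phi)
  have "wythoff (wythoff i) = wythoff i + i - 1"
    using eq g phi_bounds assms by (intro wythoff_eqI) (auto simp: of_nat_diff)
  moreover have "wythoff (Suc (wythoff i)) = wythoff i + i + 1"
    using eq g phi_bounds by (intro wythoff_eqI) (auto simp: algebra_simps)
  ultimately show ?thesis
    using assms by simp
qed

text \<open>A gap of 2 forces the fractional part \<open>f\<close> of \<open>k * phi\<close> above
  \<open>2 - phi\<close>; this keeps \<open>(wythoff k + 2) * phi\<close> below
  \<open>wythoff k + k + 3\<close>.\<close>

lemma wythoff_wythoff_of_gap:
  assumes gap: "wythoff (Suc k) = wythoff k + 2"
  shows "wythoff (wythoff k + 2) = wythoff (wythoff k + 1) + 1"
proof -
  define f where "f = real k * phi - real (wythoff k)"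
  have "real (Suc k) * phi > real (wythoff (Suc k))"
    using wythoff_bounds(1)[of "Suc k"] of_nat_mult_phi_neq_of_nat[of "Suc k" "wythoff (Suc k)"]
    by simp
  then have f: "2 - phi < f" "f < 1"
    using wythoff_bounds[of k] gap unfolding f_def by (auto simp: algebra_simps)
  have "(2 - phi) * (phi - 1) < f * (phi - 1)"
    using f phi_bounds by (intro mult_strict_right_mono) auto
  moreover have "(2 - phi) * (phi - 1) = 2 * phi - 3"
    using phi_square by (simp add: algebra_simps)
  moreover have "f * (phi - 1) < 1 * (phi - 1)"
    using f phi_bounds by (intro mult_strict_right_mono) auto
  ultimately have g: "2 * phi - 3 < f * (phi - 1)" "f * (phi - 1) < phi - 1"
    by simp_all
  have eq: "real (wythoff k) * phi = real (wythoff k) + real k - f * (phi - 1)"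
    unfolding f_def by (rule wythoff_mult_phi)
  have "wythoff (wythoff k + 1) = wythoff k + k + 1"
    using eq g phi_bounds by (intro wythoff_eqI) (auto simp: algebra_simps)
  moreover have "wythoff (wythoff k + 2) = wythoff k + k + 2"
    using eq g phi_bounds by (intro wythoff_eqI) (auto simp: algebra_simps)
  ultimately show ?thesis
    by simp
qed

section \<open>Fibonacci sums under the Wythoff map\<close>

lemma fib_Suc_eq_phi: "real (fib (Suc m)) = phi * real (fib m) + (1 - phi) ^ m"
proof (induction m rule: fib.induct)
  case (3 m)
  have sq: "(1 - phi) * (1 - phi) = (1 - phi) + 1"
    using phi_square by (simp add: algebra_simps)
  have "(1 - phi) ^ Suc (Suc m) = ((1 - phi) * (1 - phi)) * (1 - phi) ^ m"
    by simp
  also have "\<dots> = (1 - phi) ^ Suc m + (1 - phi) ^ m"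
    unfolding sq by (simp add: algebra_simps)
  finally show ?case
    using 3 by (simp add: algebra_simps)
qed auto

text \<open>The endpoints are the infinite sums of \<open>(1 - phi) ^ j\<close> over odd
  \<open>j\<close> from 3 and over even \<open>j\<close> from 2.\<close>

lemma conjugate_power_sum_bounds:
  "phi - 2 < (\<Sum>i<n. if i \<in> S then (1 - phi) ^ (i + 2) else 0) \<and>
   (\<Sum>i<n. if i \<in> S then (1 - phi) ^ (i + 2) else 0) < phi - 1"
proof (induction n arbitrary: S)
  case 0
  then show ?case
    using phi_bounds by simp
next
  case (Suc n)
  \<comment> \<open>Horner's rule: splitting off the lowest index maps the interval into itself.\<close>
  define v where "v = (\<Sum>i<n. if Suc i \<in> S then (1 - phi) ^ (i + 2) else 0)"
  have v: "phi - 2 < v" "v < phi - 1"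
    using Suc.IH[of "{i. Suc i \<in> S}"] by (auto simp: v_def)
  have eq: "(\<Sum>i<Suc n. if i \<in> S then (1 - phi) ^ (i + 2) else 0) =
      (if 0 \<in> S then (1 - phi)\<^sup>2 else 0) + (1 - phi) * v"
    by (simp add: sum.lessThan_Suc_shift v_def sum_distrib_left if_distrib power2_eq_square
        cong: if_cong del: sum.lessThan_Suc)
  have sq: "(1 - phi)\<^sup>2 = 2 - phi"
    using phi_square by (simp add: power2_eq_square algebra_simps)
  have "(phi - 1) * (phi - 2) < (phi - 1) * v" "(phi - 1) * v < (phi - 1) * (phi - 1)"
    using v phi_bounds by simp_all
  then have "2 * phi - 3 > - ((phi - 1) * v)" "- ((phi - 1) * v) > phi - 2"
    using phi_square by (simp_all add: algebra_simps)
  then show ?case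
    unfolding eq sq using phi_bounds by (auto simp: algebra_simps)
qed

lemma wythoff_Suc_sum_fib:
  assumes "S \<subseteq> {..<n}"
  shows "wythoff (Suc (\<Sum>i\<in>S. fib (i + 2))) = Suc (\<Sum>i\<in>S. fib (i + 3))"
proof -
  have "S = {..<n} \<inter> S"
    using assms by blast
  then have "(\<Sum>i\<in>S. (1 - phi) ^ (i + 2)) = (\<Sum>i<n. if i \<in> S then (1 - phi) ^ (i + 2) else 0)"
    by (metis finite_lessThan sum.inter_restrict)
  with conjugate_power_sum_bounds[of S n]
  have "phi - 2 < (\<Sum>i\<in>S. (1 - phi) ^ (i + 2))" "(\<Sum>i\<in>S. (1 - phi) ^ (i + 2)) < phi - 1"
    by simp_all
  moreover have "real (\<Sum>i\<in>S. fib (i + 3)) =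
      phi * real (\<Sum>i\<in>S. fib (i + 2)) + (\<Sum>i\<in>S. (1 - phi) ^ (i + 2))"
    using fib_Suc_eq_phi[of "_ + 2"]
    by (simp add: sum.distrib sum_distrib_left eval_nat_numeral del: fib.simps power_Suc)
  \<comment> \<open>With \<open>s\<close>, \<open>t\<close> the two Fibonacci sums and
    \<open>e\<close> the sum of powers, \<open>(1 + s) * phi = 1 + t + (phi - 1 - e)\<close>, and
    the bracket lies strictly between 0 and 1.\<close>
  ultimately show ?thesis
    by (intro wythoff_eqI) (simp_all add: algebra_simps)
qed

section \<open>Row growth and the group pattern\<close>

text \<open>
  \<open>grow a gs\<close> is what the groups \<open>gs\<close> produce when the preceding group ends in \<open>a\<close>, with the
  imagined final zero already deleted.
\<close>

fun grow :: "nat \<Rightarrow> row \<Rightarrow> row" where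
  "grow a [] = [[a, a]]"
| "grow a (h # gs) = [a, a + hd h, hd h] # middle_groups h @ grow (last h) gs"

lemma expand_nonempty [simp]: "expand (g # gs @ [[0]]) \<noteq> []"
  by (cases gs) auto

lemma expand_delete_last:
  "butlast (expand (g # gs @ [[0]])) @ [butlast (last (expand (g # gs @ [[0]])))] =
   middle_groups g @ grow (last g) gs"
  by (induction gs arbitrary: g) (auto simp: butlast_append)

lemma next_row_Cons:
  "next_row (h # gs) = [hd h, hd h] # middle_groups h @ grow (last h) gs"
  using expand_delete_last[of h gs] by (auto simp: next_row_def delete_ends_def)

lemma next_row_nonempty: "next_row r \<noteq> []"
  by (simp add: next_row_def delete_ends_def)

text \<open>
  \<open>k\<close> is the position of the first entry of the list of groups. Nothing is required at the right
  end: the last group of a row has size 2 even where the infinite pattern has size 3.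
\<close>

fun wythoff_groups :: "nat \<Rightarrow> row \<Rightarrow> bool" where
  "wythoff_groups k [] = True"
| "wythoff_groups k (h # gs) \<longleftrightarrow>
     wythoff (k + 1) = wythoff k + 1 \<and> wythoff (k + 2) = wythoff k + 3 \<and>
     (length h = 2 \<or> length h = 3 \<and> wythoff (k + 3) = wythoff k + 5) \<and>
     wythoff_groups (k + length h) gs"

text \<open>The entry \<open>a\<close> sits at position \<open>k\<close>, so its image starts at
  \<open>wythoff (k + 1) - 1\<close>, which is \<open>wythoff k + 1\<close> by the gap of 2 inside
  its group.\<close>

lemma wythoff_groups_grow:
  assumes "wythoff_groups (Suc k) gs" "wythoff (Suc k) = wythoff k + 2"
  shows "wythoff_groups (wythoff k + 1) (grow a gs)"
  using assms
proof (induction gs arbitrary: a k)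
  case Nil
  then show ?case
    using wythoff_wythoff_of_gap[of k] wythoff_Suc_wythoff[of "Suc k"]
    by (simp add: numeral_eq_Suc)
next
  case (Cons h gs)
  have w: "wythoff (k + 2) = wythoff k + 3" "wythoff (k + 3) = wythoff k + 5"
    using Cons.prems by (auto simp: numeral_eq_Suc)
  \<comment> \<open>The numbers \<open>wythoff k\<close> plus 2, 3 and 5 are values of
    \<open>wythoff\<close>, so a gap of 2 follows each; the gaps of 1 come from the gaps of 2 at
    \<open>k\<close> and \<open>k + 2\<close>.\<close>
  have e: "wythoff (wythoff k + 2) = wythoff (wythoff k + 1) + 1"
    "wythoff (wythoff k + 3) = wythoff (wythoff k + 1) + 3"
    "wythoff (wythoff k + 4) = wythoff (wythoff k + 1) + 5"
    "wythoff (wythoff k + 5) = wythoff (wythoff k + 4) + 1"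
    "wythoff (wythoff k + 6) = wythoff (wythoff k + 4) + 3"
    using wythoff_wythoff_of_gap[of k] wythoff_Suc_wythoff[of "Suc k"]
      wythoff_Suc_wythoff[of "k + 2"] wythoff_Suc_wythoff[of "k + 3"]
      wythoff_wythoff_of_gap[of "k + 2"] Cons.prems w
    by (simp_all add: numeral_eq_Suc)
  consider p q where "h = [p, q]" | p m q where "h = [p, m, q]" "wythoff (k + 4) = wythoff k + 7"
    using Cons.prems by (auto simp: numeral_eq_Suc length_Suc_conv)
  then show ?case
  proof cases
    case 1
    then have "wythoff_groups (wythoff (k + 2) + 1) (grow q gs)"
      using Cons.prems w by (intro Cons.IH) (simp_all add: numeral_eq_Suc)
    with 1 e w show ?thesis
      by (simp add: numeral_eq_Suc)
  next
    case 2
    then have "wythoff_groups (wythoff (k + 3) + 1) (grow q gs)"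
      using Cons.prems w by (intro Cons.IH) (simp_all add: numeral_eq_Suc)
    with 2 e w show ?thesis
      by (simp add: numeral_eq_Suc)
  qed
qed

lemma wythoff_groups_next_row:
  assumes "wythoff_groups 0 r" "r \<noteq> []"
  shows "wythoff_groups 0 (next_row r)"
proof -
  obtain h gs where r: "r = h # gs"
    using assms by (cases r) auto
  \<comment> \<open>A first group of size 3 would need the value 5 here.\<close>
  have e: "wythoff 3 = 4"
    using phi_bounds by (auto intro!: wythoff_eqI)
  obtain p q where h: "h = [p, q]"
    using assms e by (auto simp: r numeral_eq_Suc length_Suc_conv)
  have "wythoff_groups (wythoff 1 + 1) (grow q gs)"
    using assms by (intro wythoff_groups_grow) (simp_all add: r h numeral_2_eq_2)
  then show ?thesis
    by (simp add: r h next_row_Cons numeral_2_eq_2)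
qed

section \<open>Row growth as a linear map on polynomials\<close>

lemma Poly_grow:
  assumes "wythoff_groups k gs"
  shows "monom 1 (wythoff k) * Poly (map int (concat (grow a gs))) =
    [:1, 1:] * (monom (int a) (wythoff k) +
      (\<Sum>i<length (concat gs). monom (int (concat gs ! i)) (wythoff (k + i + 1))))"
  using assms
proof (induction gs arbitrary: a k)
  case Nil
  have "monom (int a) (wythoff k) = monom 1 (wythoff k) * [:int a:]"
    by (simp add: smult_monom)
  then show ?case
    by (simp add: algebra_simps smult_add_right)
next
  case (Cons h gs)
  define M :: "int poly" where "M = monom 1 (wythoff k)"
  have M: "monom c (wythoff k + j) = M * monom c j" for c j
    by (simp add: M_def mult_monom)
  have M0: "monom c (wythoff k) = M * [:c:]" for c
    using M[of c 0] by (simp add: monom_0)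
  have w: "wythoff (k + 1) = wythoff k + 1" "wythoff (k + 2) = wythoff k + 3"
    using Cons.prems by auto
  consider p q where "h = [p, q]" | p m q where "h = [p, m, q]" "wythoff (k + 3) = wythoff k + 5"
    using Cons.prems by (auto simp: numeral_eq_Suc length_Suc_conv)
  then show ?case
  proof cases
    case 1
    define G where "G = Poly (map int (concat (grow q gs)))"
    define R where "R = (\<Sum>i<length (concat gs). monom (int (concat gs ! i)) (wythoff (k + 2 + i + 1)))"
    have IH: "M * monom 1 3 * G = [:1, 1:] * (M * monom (int q) 3 + R)"
      using Cons.IH[of "k + 2" q] Cons.prems 1 by (simp add: G_def R_def w M)
    have sum: "(\<Sum>i<length (concat (h # gs)). monom (int (concat (h # gs) ! i)) (wythoff (k + i + 1)))
        = M * monom (int p) 1 + M * monom (int q) 3 + R"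
      using 1 w by (simp add: R_def sum.lessThan_Suc_shift M M[of _ 1, simplified] add.assoc del: sum.lessThan_Suc)
    \<comment> \<open>The group \<open>[a, a + p, p]\<close> is
      \<open>(1 + x) * (a + p * x)\<close>, and the rest starts with \<open>q\<close> at offset
      3.\<close>
    have Poly: "Poly (map int (concat (grow a (h # gs)))) =
        [:1, 1:] * ([:int a:] + monom (int p) 1) + monom 1 3 * G"
      using 1 by (simp add: G_def monom_altdef numeral_eq_Suc)
    show ?thesis
      unfolding sum Poly M_def[symmetric] unfolding M0
      by (simp only: distrib_left IH mult.assoc[symmetric]) (simp only: ac_simps)
  next
    case 2
    define G where "G = Poly (map int (concat (grow q gs)))"
    define R where "R = (\<Sum>i<length (concat gs). monom (int (concat gs ! i)) (wythoff (k + 3 + i + 1)))"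
    have w3: "wythoff (Suc (Suc (Suc k))) = wythoff k + 5"
      using 2 by (simp add: numeral_3_eq_3)
    have Suc4: "4 + j = Suc (Suc (Suc (Suc j)))" for j
      by simp
    have "wythoff_groups (k + 3) gs"
      using Cons.prems 2 by (simp add: numeral_3_eq_3)
    then have IH: "M * monom 1 5 * G = [:1, 1:] * (M * monom (int q) 5 + R)"
      using Cons.IH[of "k + 3" q] 2 by (simp add: G_def R_def w M)
    have sum: "(\<Sum>i<length (concat (h # gs)). monom (int (concat (h # gs) ! i)) (wythoff (k + i + 1)))
        = M * monom (int p) 1 + M * monom (int m) 3 + M * monom (int q) 5 + R"
      using 2 w w3 by (simp add: R_def Suc4 sum.lessThan_Suc_shift M M[of _ 1, simplified] add.assoc del: sum.lessThan_Suc)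
    have Poly: "Poly (map int (concat (grow a (h # gs)))) =
        [:1, 1:] * ([:int a:] + monom (int p) 1 + monom (int m) 3) + monom 1 5 * G"
      using 2 by (simp add: G_def monom_altdef numeral_eq_Suc)
    show ?thesis
      unfolding sum Poly M_def[symmetric] unfolding M0
      by (simp only: distrib_left IH mult.assoc[symmetric]) (simp only: ac_simps)
  qed
qed

text \<open>Exponents are not lowered by 1, which avoids truncated subtraction; the surplus factor x
  reappears below as \<open>monom 1 1\<close>.\<close>

definition spread :: "int poly \<Rightarrow> int poly" where
  "spread p = (\<Sum>i\<le>degree p. monom (coeff p i) (wythoff (i + 1)))"

lemma spread_eq:
  assumes "degree p < N"
  shows "spread p = (\<Sum>i<N. monom (coeff p i) (wythoff (i + 1)))"
  unfolding spread_def using assms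
  by (intro sum.mono_neutral_left) (auto simp: coeff_eq_0)

lemma spread_0 [simp]: "spread 0 = 0"
  by (simp add: spread_def)

lemma spread_add: "spread (p + q) = spread p + spread q"
proof -
  define N where "N = Suc (max (degree p) (degree q))"
  have "degree p < N" "degree q < N" "degree (p + q) < N"
    using degree_add_le_max[of p q] by (auto simp: N_def)
  then show ?thesis
    by (simp add: spread_eq[where N = N] sum.distrib flip: add_monom)
qed

lemma spread_sum: "finite A \<Longrightarrow> spread (\<Sum>x\<in>A. f x) = (\<Sum>x\<in>A. spread (f x))"
  by (induction A rule: finite_induct) (simp_all add: spread_add)

lemma spread_monom: "spread (monom 1 k) = monom 1 (wythoff (k + 1))"
proof -
  have "spread (monom 1 k) = (\<Sum>i\<le>k. monom (if k = i then 1 else 0) (wythoff (i + 1)))"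
    by (simp add: spread_def degree_monom_eq)
  also have "\<dots> = (\<Sum>i\<le>k. if k = i then monom 1 (wythoff (i + 1)) else 0)"
    by (rule sum.cong) auto
  finally show ?thesis
    by simp
qed

lemma spread_Poly:
  "spread (Poly (map int xs)) = (\<Sum>i<length xs. monom (int (xs ! i)) (wythoff (i + 1)))"
proof -
  define N where "N = Suc (max (degree (Poly (map int xs))) (length xs))"
  have "spread (Poly (map int xs)) = (\<Sum>i<N. monom (coeff (Poly (map int xs)) i) (wythoff (i + 1)))"
    by (rule spread_eq) (simp add: N_def)
  also have "\<dots> = (\<Sum>i<length xs. monom (int (xs ! i)) (wythoff (i + 1)))"
    by (intro sum.mono_neutral_cong_right) (auto simp: N_def nth_default_def)
  finally show ?thesis .
qed

lemma Poly_next_row: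
  assumes "wythoff_groups 0 r" "r \<noteq> []"
  shows "monom 1 1 * Poly (map int (concat (next_row r))) =
    [:1, 1:] * spread (Poly (map int (concat r)))"
proof -
  obtain h gs where r: "r = h # gs"
    using assms by (cases r) auto
  \<comment> \<open>Growing from the imagined left zero keeps that zero in front, which accounts for
    the factor x.\<close>
  have "concat (grow 0 r) = 0 # concat (next_row r)"
    by (simp add: r next_row_Cons)
  then have "monom 1 1 * Poly (map int (concat (next_row r))) = Poly (map int (concat (grow 0 r)))"
    by (simp add: monom_altdef)
  then show ?thesis
    using Poly_grow[OF assms(1), of 0] by (simp add: spread_Poly)
qed

lemma prod_one_plus_monom:
  fixes f :: "'b \<Rightarrow> nat"
  assumes "finite A"
  shows "(\<Prod>i\<in>A. 1 + monom (1 :: 'a :: comm_semiring_1) (f i)) = (\<Sum>S\<in>Pow A. monom 1 (\<Sum>i\<in>S. f i))"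
proof -
  have "(\<Prod>i\<in>S. monom (1 :: 'a) (f i)) = monom 1 (\<Sum>i\<in>S. f i)" for S
    by (induction S rule: infinite_finite_induct) (simp_all add: mult_monom)
  then show ?thesis
    using prod_add[OF assms, of "\<lambda>i. monom (1 :: 'a) (f i)" "\<lambda>_. 1"] by (simp add: add.commute)
qed

section \<open>The product formula by induction on rows\<close>

lemma spread_prod_fib:
  "spread (\<Prod>i<n. 1 + monom 1 (fib (i + 2))) = monom 1 1 * (\<Prod>i<n. 1 + monom 1 (fib (i + 3)))"
proof -
  have "spread (\<Prod>i<n. 1 + monom 1 (fib (i + 2))) =
      (\<Sum>S\<in>Pow {..<n}. monom 1 (wythoff (Suc (\<Sum>i\<in>S. fib (i + 2)))))"
    by (simp add: prod_one_plus_monom spread_sum spread_monom)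
  also have "\<dots> = (\<Sum>S\<in>Pow {..<n}. monom 1 (Suc (\<Sum>i\<in>S. fib (i + 3))))"
    by (intro sum.cong refl) (metis PowD wythoff_Suc_sum_fib)
  also have "\<dots> = monom 1 1 * (\<Prod>i<n. 1 + monom 1 (fib (i + 3)))"
    by (simp add: prod_one_plus_monom sum_distrib_left mult_monom)
  finally show ?thesis .
qed

lemma H_eq_Poly: "H n = Poly (map int (concat (fib_row n)))"
  by (rule poly_eqI) (simp add: coeff_H entry_def nth_default_def)

lemma fib_row_Suc_wythoff_groups: "fib_row (Suc n) \<noteq> [] \<and> wythoff_groups 0 (fib_row (Suc n))"
proof (induction n)
  case (Suc n)
  then show ?case
    using wythoff_groups_next_row[of "fib_row (Suc n)"] by (simp add: next_row_nonempty)
qed simp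

lemma H_Suc: "H (Suc n) = (\<Prod>i<Suc n. 1 + monom 1 (fib (i + 2)))"
proof (induction n)
  case 0
  show ?case
    by (simp add: H_eq_Poly monom_altdef one_pCons)
next
  case (Suc n)
  have "monom 1 1 * H (Suc (Suc n)) = [:1, 1:] * spread (H (Suc n))"
    using fib_row_Suc_wythoff_groups[of n] unfolding H_eq_Poly
    by (subst Poly_next_row[symmetric]) simp_all
  also have "\<dots> = monom 1 1 * ([:1, 1:] * (\<Prod>i<Suc n. 1 + monom 1 (fib (i + 3))))"
    unfolding Suc.IH spread_prod_fib by (simp only: ac_simps)
  \<comment> \<open>Since \<open>fib 2 = 1\<close>, the factor 1 + x is the missing factor at index
    0.\<close>
  also have "[:1, 1:] * (\<Prod>i<Suc n. 1 + monom 1 (fib (i + 3))) =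
      (\<Prod>i<Suc (Suc n). 1 + monom (1 :: int) (fib (i + 2)))"
  proof -
    have "1 + monom (1 :: int) (fib (0 + 2)) = [:1, 1:]"
      by (simp add: monom_altdef one_pCons)
    then show ?thesis
      unfolding prod.lessThan_Suc_shift[of _ "Suc n"]
      by (simp only: add_Suc add_Suc_right add_0_right numeral_2_eq_2 numeral_3_eq_3)
  qed
  finally show ?case
    by (simp only: mult_cancel_left) (simp add: monom_eq_0_iff)
qed

theorem theorem3:
  fixes n :: nat
  assumes "n \<ge> 1"
  shows "H n = (\<Prod>i = 1..n. 1 + monom 1 (fib (i + 1)))"
proof -
  obtain m where n: "n = Suc m"
    using assms by (cases n) auto
  have "(\<Prod>i<n. 1 + monom (1 :: int) (fib (i + 2))) = (\<Prod>i = 1..n. 1 + monom 1 (fib (i + 1)))"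
    by (rule prod.reindex_bij_witness[of _ "\<lambda>i. i - 1" Suc]) auto
  then show ?thesis
    using H_Suc[of m] n by simp
qed

end
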